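(* Let $d\ge1$, let $A=a_dx^d+a_{d-1}x^{d-1}+\cdots+a_1x+a_0\in\mathbb{Z}[x]$, $a_0\ge2$, $a_d\ne0$, be an expanding polynomial, and let $\mathbf{r}=\big(\frac{a_d}{a_0},\frac{a_{d-1}}{a_0},\ldots,\frac{a_1}{a_0}\big)$. Then $$\mathcal{G}_A\big(\Psi_A^{-1}(\mathbf{z})\big)=V\,\mathcal{T}_\mathbf{r}(\mathbf{z})\quad\text{for all }\mathbf{z}\in\mathbb{Z}^d.$$
   Context: A polynomial is expanding if all its complex roots have modulus strictly larger than $1$. The lower Hausdorff limit $\mathrm{Li}_{n\to\infty}A_n$ of subsets $A_n\subseteq\mathbb{R}^d$ is the set of all $\mathbf{t}\in\mathbb{R}^d$ such that each neighbourhood of $\mathbf{t}$ intersects $A_n$ for all sufficiently large $n$. SRS tiles. For $\mathbf{r}=(r_0,\ldots,r_{d-1})\in\mathbb{R}^d$ and $\mathbf{z}=(z_0,\ldots,z_{d-1})^t\in\mathbb{Z}^d$ put $\mathbf{r}\mathbf{z}=\sum_ir_iz_i$, $\tau_\mathbf{r}(\mathbf{z})=(z_1,\ldots,z_{d-1},-\lfloor\mathbf{r}\mathbf{z}\rfloor)^t\in\mathbb{Z}^d$, $\tau_\mathbf{r}^{-n}(\mathbf{x})=\{\mathbf{z}\in\mathbb{Z}^d\mid\tau_\mathbf{r}^n(\mathbf{z})=\mathbf{x}\}$. The companion matrix $M_\mathbf{r}\in\mathbb{R}^{d\times d}$ has last row $(-r_0,\ldots,-r_{d-1})$, entries $1$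 on the superdiagonal of the first $d-1$ rows, and $0$ elsewhere (for $d=1$, $M_\mathbf{r}=(-r_0)$). If $r_0\neq0$ and $M_\mathbf{r}$ has spectral radius $<1$ (true here because $A$ is expanding and $a_d\ne 0$), the SRS tile is $\mathcal{T}_\mathbf{r}(\mathbf{x})=\mathrm{Li}_{n\to\infty}M_\mathbf{r}^n\tau_\mathbf{r}^{-n}(\mathbf{x})$, $\mathbf{x}\in\mathbb{Z}^d$. Brunotte tiles. Let $\mathcal{Q}=\mathbb{Z}[x]/A\mathbb{Z}[x]$ and let $X$ be the image of $x$ in $\mathcal{Q}$. The backward division mapping $D_A:\mathcal{Q}\to\mathcal{Q}$ is the well-defined map sending $P=\sum_{i=0}^\ell p_iX^i$ ($p_i\in\mathbb{Z}$) to $D_A(P)=\sum_{i=0}^{\ell-1}p_{i+1}X^i-\sum_{i=0}^{d-1}q\,a_{i+1}X^i$, $q=\lfloor p_0/a_0\rfloor$; $D_A^{-n}(P)$ denotes the preimage of $P$ under $D_A^n$. Let $W_0=a_d$ and $W_k=XW_{k-1}+a_{d-k}$ for $1\le k\le d-1$ (elements of $\mathcal{Q}$). The Brunotte module $\Lambda_A$ is the $\mathbb{Z}$-submodule of $\mathcal{Q}$ generated by $W_0,\ldots,W_{d-1}$ (which are a basis of it), and $\Psi_A:\Lambda_A\to\mathbb{Z}^d$ is the bijection $\sum_{k=0}^{d-1}z_kW_k\mapsto(z_0,\ldots,z_{d-1})^t$. Let $V\in\mathbb{R}^{d\times d}$ be upper triangular with $V_{ij}=a_{d-(j-i)}$ for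 $1\le i\le j\le d$ and $V_{ij}=0$ for $i>j$, and $B=VM_\mathbf{r}^{-1}V^{-1}$. For $P\in\Lambda_A$ the Brunotte tile is $\mathcal{G}_A(P)=\mathrm{Li}_{n\to\infty}B^{-n}V\Psi_A\big(D_A^{-n}(P)\cap\Lambda_A\big)$. *)

theory Defs
  imports
    "HOL-Analysis.L2_Norm"
    "HOL-Algebra.QuotRing"
    "HOL-Algebra.Generated_Groups"
    "Jordan_Normal_Form.VS_Connect"
    "Jordan_Normal_Form.Gauss_Jordan_Elimination"
begin

text \<open>
  The dimension \<open>d\<close> is the degree of the polynomial, so \<open>\<real>\<^sup>d\<close>, \<open>\<int>\<^sup>d\<close> and the \<open>d \<times> d\<close> matrices are
  carriers of the types of vectors and matrices of Jordan_Normal_Form. All indices start at \<open>0\<close>.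
\<close>

definition expanding :: "int poly \<Rightarrow> bool" where
  "expanding A \<longleftrightarrow> (\<forall>z::complex. poly (map_poly of_int A) z = 0 \<longrightarrow> 1 < cmod z)"

text \<open>
  Vectors carry no topology in Jordan_Normal_Form; the neighbourhoods of \<open>t\<close> are the sets
  containing some Euclidean ball around \<open>t\<close>.
\<close>

definition lower_hausdorff_limit :: "nat \<Rightarrow> (nat \<Rightarrow> real vec set) \<Rightarrow> real vec set" where
  "lower_hausdorff_limit d S = {t \<in> carrier_vec d.
     \<forall>\<epsilon>>0. \<forall>\<^sub>F n in sequentially. \<exists>x \<in> S n. L2_set (\<lambda>i. x $ i - t $ i) {..<d} < \<epsilon>}"

text \<open>Meaningful for invertible matrices only; \<^const>\<open>mat_inverse\<close> is \<^const>\<open>None\<close> for the others.\<close>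

abbreviation mat_inv :: "real mat \<Rightarrow> real mat" where
  "mat_inv M \<equiv> the (mat_inverse M)"

abbreviation real_vec :: "int vec \<Rightarrow> real vec" where
  "real_vec \<equiv> map_vec real_of_int"

section \<open>SRS tiles\<close>

definition srs_map :: "real vec \<Rightarrow> int vec \<Rightarrow> int vec" where
  "srs_map r z = vec (dim_vec r)
     (\<lambda>i. if i + 1 < dim_vec r then z $ (i + 1) else - \<lfloor>r \<bullet> real_vec z\<rfloor>)"

definition companion_mat :: "real vec \<Rightarrow> real mat" where
  "companion_mat r = mat (dim_vec r) (dim_vec r)
     (\<lambda>(i, j). if i + 1 = dim_vec r then - (r $ j) else if j = i + 1 then 1 else 0)"

text \<open>
  Used only for \<open>r\<^sub>0 \<noteq> 0\<close> and \<^term>\<open>companion_mat r\<close> of spectral radius less than \<open>1\<close>; the defining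
  formula itself does not need these conditions.
\<close>

definition srs_tile :: "real vec \<Rightarrow> int vec \<Rightarrow> real vec set" where
  "srs_tile r x = lower_hausdorff_limit (dim_vec r)
     (\<lambda>n. (\<lambda>z. (companion_mat r ^\<^sub>m n) *\<^sub>v real_vec z) `
            {z \<in> carrier_vec (dim_vec r). (srs_map r ^^ n) z = x})"

section \<open>Brunotte tiles\<close>

definition poly_ideal :: "int poly \<Rightarrow> int poly set" where
  "poly_ideal A = PIdl\<^bsub>class_ring\<^esub> A"

definition quot_ring :: "int poly \<Rightarrow> int poly set ring" where
  "quot_ring A = class_ring Quot poly_ideal A"

definition quot_class :: "int poly \<Rightarrow> int poly \<Rightarrow> int poly set" where
  "quot_class A p = poly_ideal A +>\<^bsub>class_ring\<^esub> p"

definition back_div_poly :: "int poly \<Rightarrow> int poly \<Rightarrow> int poly" where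
  "back_div_poly A p =
     (let q = \<lfloor>real_of_int (coeff p 0) / real_of_int (coeff A 0)\<rfloor>
      in (\<Sum>i<degree p. monom (coeff p (i + 1)) i) -
         (\<Sum>i<degree A. monom (q * coeff A (i + 1)) i))"

text \<open>
  For \<open>a\<^sub>0 \<noteq> 0\<close> the image below is a singleton, whichever representatives \<open>p\<close> of \<open>P\<close> are used: see
  \<open>back_div_quot_class\<close>.
\<close>

definition back_div :: "int poly \<Rightarrow> int poly set \<Rightarrow> int poly set" where
  "back_div A P = the_elem ((\<lambda>p. quot_class A (back_div_poly A p)) ` P)"

lemma mem_poly_ideal: "p \<in> poly_ideal A \<longleftrightarrow> A dvd p"
  by (auto simp: poly_ideal_def cgenideal_def dvd_def mult.commute)

lemma mem_quot_class: "p \<in> quot_class A q \<longleftrightarrow> A dvd p - q"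
proof -
  have "p \<in> quot_class A q \<longleftrightarrow> (\<exists>h \<in> poly_ideal A. p = h + q)"
    by (auto simp: quot_class_def a_r_coset_def r_coset_def)
  also have "\<dots> \<longleftrightarrow> p - q \<in> poly_ideal A"
    by (metis add_diff_cancel_right' diff_add_cancel)
  finally show ?thesis
    by (simp add: mem_poly_ideal)
qed

lemma quot_class_eq_iff: "quot_class A p = quot_class A q \<longleftrightarrow> A dvd p - q"
proof
  assume "quot_class A p = quot_class A q"
  moreover have "p \<in> quot_class A p"
    by (simp add: mem_quot_class)
  ultimately show "A dvd p - q"
    by (simp add: mem_quot_class)
next
  assume "A dvd p - q"
  then have "A dvd x - p \<longleftrightarrow> A dvd x - q" for x
    using dvd_add[of A "x - p" "p - q"] dvd_diff[of A "x - q" "p - q"] by auto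
  then show "quot_class A p = quot_class A q"
    by (auto simp: mem_quot_class)
qed

lemma coeff_back_div_poly:
  "coeff (back_div_poly A p) i = coeff p (i + 1) - coeff p 0 div coeff A 0 * coeff A (i + 1)"
proof -
  have "coeff (\<Sum>i<degree f. monom (c * coeff f (i + 1)) i) i = c * coeff f (i + 1)"
    for c :: int and f i
    by (auto simp: coeff_sum coeff_monom if_distrib[of "(*) _"] le_degree coeff_eq_0)
  from this[of 1 p i] this[of "coeff p 0 div coeff A 0" A i] show ?thesis
    by (simp add: back_div_poly_def Let_def floor_divide_of_int_eq)
qed

lemma back_div_quot_class:
  assumes "coeff A 0 \<noteq> 0"
  shows "back_div A (quot_class A p) = quot_class A (back_div_poly A p)"
proof -
  have "quot_class A (back_div_poly A p') = quot_class A (back_div_poly A p)"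
    if "p' \<in> quot_class A p" for p'
  proof -
    from that obtain h where h: "p' = p + A * h"
      by (auto simp: mem_quot_class dvd_def algebra_simps)
    have q: "coeff p' 0 div coeff A 0 = coeff p 0 div coeff A 0 + coeff h 0"
      using assms by (simp add: h coeff_mult div_plus_div_distrib_dvd_right)
    have "back_div_poly A p' - back_div_poly A p = A * poly_shift 1 h"
    proof (rule poly_eqI)
      fix i
      have "coeff (A * h) (Suc i) = (\<Sum>j\<le>i. coeff A j * coeff h (Suc i - j)) + coeff A (Suc i) * coeff h 0"
        by (simp add: coeff_mult)
      also have "(\<Sum>j\<le>i. coeff A j * coeff h (Suc i - j)) = coeff (A * poly_shift 1 h) i"
        by (simp add: coeff_mult coeff_poly_shift Suc_diff_le)
      finally show "coeff (back_div_poly A p' - back_div_poly A p) i = coeff (A * poly_shift 1 h) i"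
        unfolding coeff_diff coeff_back_div_poly q by (simp add: h algebra_simps)
    qed
    then show ?thesis
      by (simp add: quot_class_eq_iff)
  qed
  moreover have "p \<in> quot_class A p"
    by (simp add: mem_quot_class)
  ultimately have "(\<lambda>p. quot_class A (back_div_poly A p)) ` quot_class A p = {quot_class A (back_div_poly A p)}"
    by blast
  then show ?thesis
    by (simp add: back_div_def)
qed

primrec brunotte_basis :: "int poly \<Rightarrow> nat \<Rightarrow> int poly set" where
  "brunotte_basis A 0 = quot_class A [:coeff A (degree A):]"
| "brunotte_basis A (Suc k) =
     (quot_class A [:0, 1:] \<otimes>\<^bsub>quot_ring A\<^esub> brunotte_basis A k)
       \<oplus>\<^bsub>quot_ring A\<^esub> quot_class A [:coeff A (degree A - Suc k):]"

text \<open>A \<open>\<int>\<close>-submodule of the quotient ring is a subgroup of its additive group.\<close>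

definition brunotte_module :: "int poly \<Rightarrow> int poly set set" where
  "brunotte_module A = generate (add_monoid (quot_ring A)) (brunotte_basis A ` {..<degree A})"

definition brunotte_comb :: "int poly \<Rightarrow> int vec \<Rightarrow> int poly set" where
  "brunotte_comb A z =
     (\<Oplus>\<^bsub>quot_ring A\<^esub> k \<in> {..<degree A}. [z $ k] \<cdot>\<^bsub>quot_ring A\<^esub> brunotte_basis A k)"

definition brunotte_coord :: "int poly \<Rightarrow> int poly set \<Rightarrow> int vec" where
  "brunotte_coord A = the_inv_into (carrier_vec (degree A)) (brunotte_comb A)"

definition srs_param :: "int poly \<Rightarrow> real vec" where
  "srs_param A = vec (degree A)
     (\<lambda>i. real_of_int (coeff A (degree A - i)) / real_of_int (coeff A 0))"

definition V_mat :: "int poly \<Rightarrow> real mat" where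
  "V_mat A = mat (degree A) (degree A)
     (\<lambda>(i, j). if i \<le> j then real_of_int (coeff A (degree A - (j - i))) else 0)"

definition B_mat :: "int poly \<Rightarrow> real mat" where
  "B_mat A = V_mat A * mat_inv (companion_mat (srs_param A)) * mat_inv (V_mat A)"

definition brunotte_tile :: "int poly \<Rightarrow> int poly set \<Rightarrow> real vec set" where
  "brunotte_tile A P = lower_hausdorff_limit (degree A)
     (\<lambda>n. (\<lambda>Q. (mat_inv (B_mat A) ^\<^sub>m n) *\<^sub>v (V_mat A *\<^sub>v real_vec (brunotte_coord A Q))) `
            ({Q \<in> carrier (quot_ring A). (back_div A ^^ n) Q = P} \<inter> brunotte_module A))"

end

theory Submission
  imports Defs
begin

text \<open>
  In the basis \<open>W\<^sub>0, \<dots>, W\<^bsub>d-1\<^esub>\<close> the backward division mapping is the shift radix system map: \<open>W\<^sub>k\<close> has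
  constant coefficient \<open>a\<^bsub>d-k\<^esub>\<close>, so the quotient taken by \<open>D\<^sub>A\<close> at \<open>\<Sum> z\<^sub>k W\<^sub>k\<close> is \<open>\<lfloor>r z\<rfloor>\<close>; removing constant
  coefficients and dividing by
  \<open>X\<close> sends \<open>W\<^sub>k\<close> to \<open>W\<^bsub>k-1\<^esub>\<close>, and \<open>(A - a\<^sub>0) / X = W\<^bsub>d-1\<^esub>\<close>. Hence \<open>D\<^sub>A\<^sup>-\<^sup>n(P) \<inter> \<Lambda>\<^sub>A\<close> corresponds
  to \<open>\<tau>\<^sub>r\<^sup>-\<^sup>n(z)\<close>. Since \<open>B\<^sup>-\<^sup>n V = V M\<^sub>r\<^sup>n\<close>, the sets approximating the Brunotte tile are the \<open>V\<close>-images
  of those approximating the SRS tile, and the lower Hausdorff limit commutes with \<open>V\<close>.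
\<close>

section \<open>Lower Hausdorff limits under linear maps\<close>

text \<open>Each coordinate of \<open>x\<close> is at most its Euclidean norm, so the sum of the
  absolute values of all entries of \<open>W\<close> bounds the operator norm.\<close>

lemma mult_mat_vec_L2_set_bound:
  fixes W :: "real mat"
  assumes W: "W \<in> carrier_mat d d"
  obtains K where "K > 0" and
    "\<And>x. x \<in> carrier_vec d \<Longrightarrow> L2_set (\<lambda>i. (W *\<^sub>v x) $ i) {..<d} \<le> K * L2_set (($) x) {..<d}"
proof
  let ?K = "\<Sum>i<d. \<Sum>j<d. \<bar>W $$ (i, j)\<bar>"
  \<comment> \<open>The added 1 keeps the constant positive even for a zero matrix, so that one can
    later divide by it.\<close>
  show "?K + 1 > 0"
    by (intro add_nonneg_pos sum_nonneg) auto
  fix x :: "real vec" assume x: "x \<in> carrier_vec d"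
  let ?x = "L2_set (($) x) {..<d}"
  have entry: "\<bar>x $ j\<bar> \<le> ?x" if "j < d" for j
    using member_le_L2_set[of "{..<d}" j "\<lambda>i. \<bar>x $ i\<bar>"] that by (simp add: L2_set_def)
  have "L2_set (\<lambda>i. (W *\<^sub>v x) $ i) {..<d} \<le> (\<Sum>i<d. \<bar>(W *\<^sub>v x) $ i\<bar>)"
    by (rule L2_set_le_sum_abs)
  also have "\<dots> \<le> (\<Sum>i<d. \<Sum>j<d. \<bar>W $$ (i, j)\<bar> * ?x)"
  proof (rule sum_mono)
    fix i assume i: "i \<in> {..<d}"
    have "\<bar>(W *\<^sub>v x) $ i\<bar> = \<bar>\<Sum>j<d. W $$ (i, j) * x $ j\<bar>"
      using i W x by (simp add: scalar_prod_def atLeast0LessThan)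
    also have "\<dots> \<le> (\<Sum>j<d. \<bar>W $$ (i, j) * x $ j\<bar>)"
      by (rule sum_abs)
    also have "\<dots> \<le> (\<Sum>j<d. \<bar>W $$ (i, j)\<bar> * ?x)"
      by (intro sum_mono) (auto simp: abs_mult intro!: mult_left_mono entry)
    finally show "\<bar>(W *\<^sub>v x) $ i\<bar> \<le> (\<Sum>j<d. \<bar>W $$ (i, j)\<bar> * ?x)" .
  qed
  also have "\<dots> = ?K * ?x"
    by (simp add: sum_distrib_right)
  also have "\<dots> \<le> (?K + 1) * ?x"
    by (simp add: distrib_right)
  finally show "L2_set (\<lambda>i. (W *\<^sub>v x) $ i) {..<d} \<le> (?K + 1) * ?x" .
qed

text \<open>Lipschitz continuity suffices here: a point of \<open>S n\<close> within
  \<open>e / K\<close> of \<open>t\<close> is sent to a point within \<open>e\<close> of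
  \<open>W t\<close>.\<close>

lemma image_lower_hausdorff_limit_subset:
  assumes W: "W \<in> carrier_mat d d" and S: "\<And>n. S n \<subseteq> carrier_vec d"
  shows "(\<lambda>t. W *\<^sub>v t) ` lower_hausdorff_limit d S \<subseteq> lower_hausdorff_limit d (\<lambda>n. (\<lambda>t. W *\<^sub>v t) ` S n)"
proof (rule image_subsetI)
  fix t assume t: "t \<in> lower_hausdorff_limit d S"
  then have tc: "t \<in> carrier_vec d"
    by (simp add: lower_hausdorff_limit_def)
  obtain K where K: "K > 0" and
    bound: "\<And>x. x \<in> carrier_vec d \<Longrightarrow> L2_set (\<lambda>i. (W *\<^sub>v x) $ i) {..<d} \<le> K * L2_set (($) x) {..<d}"
    using mult_mat_vec_L2_set_bound[OF W] by blast
  have dist: "L2_set (\<lambda>i. (W *\<^sub>v x) $ i - (W *\<^sub>v t) $ i) {..<d} \<le> K * L2_set (\<lambda>i. x $ i - t $ i) {..<d}"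
    if x: "x \<in> carrier_vec d" for x
  proof -
    have "L2_set (\<lambda>i. (W *\<^sub>v (x - t)) $ i) {..<d} = L2_set (\<lambda>i. (W *\<^sub>v x) $ i - (W *\<^sub>v t) $ i) {..<d}"
      using W tc x by (intro L2_set_cong) 
        (simp_all add: mult_minus_distrib_mat_vec[OF W x tc] del: index_mult_mat_vec)
    moreover have "L2_set (($) (x - t)) {..<d} = L2_set (\<lambda>i. x $ i - t $ i) {..<d}"
      using tc x by (intro L2_set_cong) auto
    ultimately show ?thesis
      using bound[of "x - t"] tc x by simp
  qed
  have "\<forall>\<^sub>F n in sequentially. \<exists>y \<in> (\<lambda>t. W *\<^sub>v t) ` S n. L2_set (\<lambda>i. y $ i - (W *\<^sub>v t) $ i) {..<d} < e"
    if e: "e > 0" for e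
  proof -
    have "\<forall>\<^sub>F n in sequentially. \<exists>x \<in> S n. L2_set (\<lambda>i. x $ i - t $ i) {..<d} < e / K"
      using t e K by (simp add: lower_hausdorff_limit_def)
    then show ?thesis
    proof eventually_elim
      case (elim n)
      then obtain x where x: "x \<in> S n" and "L2_set (\<lambda>i. x $ i - t $ i) {..<d} < e / K"
        by blast
      then have "K * L2_set (\<lambda>i. x $ i - t $ i) {..<d} < e"
        using K by (simp add: field_simps)
      with dist[of x] x S[of n] show ?case
        by (intro bexI[of _ "W *\<^sub>v x"]) auto
    qed
  qed
  then show "W *\<^sub>v t \<in> lower_hausdorff_limit d (\<lambda>n. (\<lambda>t. W *\<^sub>v t) ` S n)"
    using W tc by (auto simp: lower_hausdorff_limit_def)
qed

text \<open>One inclusion is the preceding lemma for \<open>W\<close>. The other is the same lemma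
  for \<open>W'\<close>, applied to the image sets, and carried back by \<open>W\<close>.\<close>

lemma lower_hausdorff_limit_image:
  assumes W: "W \<in> carrier_mat d d" and W': "W' \<in> carrier_mat d d"
    and inv: "W * W' = 1\<^sub>m d" "W' * W = 1\<^sub>m d"
    and S: "\<And>n. S n \<subseteq> carrier_vec d"
  shows "lower_hausdorff_limit d (\<lambda>n. (\<lambda>t. W *\<^sub>v t) ` S n) = (\<lambda>t. W *\<^sub>v t) ` lower_hausdorff_limit d S"
proof
  have carr: "lower_hausdorff_limit d T \<subseteq> carrier_vec d" for T
    by (auto simp: lower_hausdorff_limit_def)
  have 1: "W *\<^sub>v (W' *\<^sub>v t) = t" "W' *\<^sub>v (W *\<^sub>v t) = t" if "t \<in> carrier_vec d" for t
    using that W W' inv by (simp_all flip: assoc_mult_mat_vec)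
  let ?L = "lower_hausdorff_limit d (\<lambda>n. (\<lambda>t. W *\<^sub>v t) ` S n)"
  have "(\<lambda>t. W' *\<^sub>v t) ` ?L \<subseteq> lower_hausdorff_limit d (\<lambda>n. (\<lambda>t. W' *\<^sub>v t) ` (\<lambda>t. W *\<^sub>v t) ` S n)"
    using S W by (intro image_lower_hausdorff_limit_subset[OF W'])
      (auto intro!: mult_mat_vec_carrier)
  also have "(\<lambda>n. (\<lambda>t. W' *\<^sub>v t) ` (\<lambda>t. W *\<^sub>v t) ` S n) = S"
  proof
    fix n
    have "(\<lambda>t. W' *\<^sub>v (W *\<^sub>v t)) ` S n = (\<lambda>t. t) ` S n"
      using S by (intro image_cong refl 1(2)) blast
    then show "(\<lambda>t. W' *\<^sub>v t) ` (\<lambda>t. W *\<^sub>v t) ` S n = S n"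
      by (simp add: image_image)
  qed
  finally have sub: "(\<lambda>t. W' *\<^sub>v t) ` ?L \<subseteq> lower_hausdorff_limit d S" .
  show "?L \<subseteq> (\<lambda>t. W *\<^sub>v t) ` lower_hausdorff_limit d S"
  proof
    fix t assume t: "t \<in> ?L"
    with carr have "t \<in> carrier_vec d"
      by blast
    then have "t = W *\<^sub>v (W' *\<^sub>v t)"
      by (rule 1(1)[symmetric])
    with sub t show "t \<in> (\<lambda>t. W *\<^sub>v t) ` lower_hausdorff_limit d S"
      by blast
  qed
  show "(\<lambda>t. W *\<^sub>v t) ` lower_hausdorff_limit d S \<subseteq> ?L"
    by (rule image_lower_hausdorff_limit_subset[OF W S])
qed

section \<open>The matrices\<close>

text \<open>A one-sided inverse of a square matrix over a field is two-sided, so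
  \<open>mat_inverse\<close> succeeds, and its result must be \<open>N\<close> by
  associativity.\<close>

lemma mat_inv_unique:
  fixes M :: "real mat"
  assumes M: "M \<in> carrier_mat n n" and N: "N \<in> carrier_mat n n" and "M * N = 1\<^sub>m n"
  shows "mat_inv M = N"
proof -
  have NM: "N * M = 1\<^sub>m n"
    using assms by (rule mat_mult_left_right_inverse)
  have "M \<in> Units (ring_mat TYPE(real) n ())"
    using assms NM by (auto simp: Units_def ring_mat_simps)
  with mat_inverse(1)[OF M, of "()"] obtain M' where M': "mat_inverse M = Some M'"
    by (cases "mat_inverse M") auto
  from mat_inverse(2)[OF M M'] have "M' = M' * (M * N)" "M' * M = 1\<^sub>m n" "M' \<in> carrier_mat n n"
    using assms by auto
  then have "M' = N"
    using M N by (metis assoc_mult_mat left_mult_one_mat)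
  with M' show ?thesis
    by simp
qed

lemma mat_inv_inverse:
  fixes M :: "real mat"
  assumes M: "M \<in> carrier_mat n n" and "det M \<noteq> 0"
  shows "mat_inv M \<in> carrier_mat n n" "M * mat_inv M = 1\<^sub>m n" "mat_inv M * M = 1\<^sub>m n"
proof -
  from det_non_zero_imp_unit[OF assms, of "()"] mat_inverse(1)[OF M, of "()"]
  obtain M' where "mat_inverse M = Some M'"
    by (cases "mat_inverse M") auto
  with mat_inverse(2)[OF M] show "mat_inv M \<in> carrier_mat n n" "M * mat_inv M = 1\<^sub>m n" "mat_inv M * M = 1\<^sub>m n"
    by auto
qed

lemma companion_mat_carrier: "companion_mat r \<in> carrier_mat (dim_vec r) (dim_vec r)"
  by (simp add: companion_mat_def)

text \<open>The kernel is trivial: row \<open>i\<close>, other than the last, reads off coordinate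
  \<open>i + 1\<close> of the vector, and the last row then leaves only the multiple of
  \<open>v $ 0\<close> by \<open>- (r $ 0)\<close>.\<close>

lemma det_companion_mat_nonzero:
  assumes r: "0 < dim_vec r" "r $ 0 \<noteq> 0"
  shows "det (companion_mat r) \<noteq> 0"
proof
  let ?d = "dim_vec r"
  assume "det (companion_mat r) = 0"
  then obtain v where v: "v \<in> carrier_vec ?d" "v \<noteq> 0\<^sub>v ?d" "companion_mat r *\<^sub>v v = 0\<^sub>v ?d"
    using det_0_iff_vec_prod_zero[OF companion_mat_carrier] by blast
  have row: "(\<Sum>j<?d. companion_mat r $$ (i, j) * v $ j) = 0" if "i < ?d" for i
  proof -
    have "(companion_mat r *\<^sub>v v) $ i = 0"
      using v that by simp
    then show ?thesis
      using that v(1) companion_mat_carrier[of r] by (simp add: scalar_prod_def atLeast0LessThan)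
  qed
  have Suc0: "v $ Suc i = 0" if "Suc i < ?d" for i
  proof -
    have "(\<Sum>j<?d. companion_mat r $$ (i, j) * v $ j) = (\<Sum>j<?d. if j = Suc i then v $ j else 0)"
      using that by (intro sum.cong) (auto simp: companion_mat_def)
    with row[of i] that show ?thesis
      by simp
  qed
  have zero: "v $ 0 = 0"
  proof -
    \<comment> \<open>All terms with \<open>j > 0\<close> vanish by \<open>Suc0\<close>.\<close>
    have "(\<Sum>j<?d. companion_mat r $$ (?d - 1, j) * v $ j) = (\<Sum>j<?d. if j = 0 then - (r $ 0) * v $ 0 else 0)"
    proof (intro sum.cong refl)
      fix j assume "j \<in> {..<?d}"
      then show "companion_mat r $$ (?d - 1, j) * v $ j = (if j = 0 then - (r $ 0) * v $ 0 else 0)"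
        using Suc0 by (cases j) (auto simp: companion_mat_def)
    qed
    with row[of "?d - 1"] r show ?thesis
      by simp
  qed
  have "v $ i = 0" if "i < ?d" for i
    using that zero Suc0 by (cases i) auto
  with v(1,2) show False
    by (metis carrier_vecD eq_vecI index_zero_vec)
qed

lemma V_mat_carrier: "V_mat A \<in> carrier_mat (degree A) (degree A)"
  by (simp add: V_mat_def)

text \<open>The matrix is upper triangular with the leading coefficient of \<open>A\<close> all
  along its diagonal.\<close>

lemma det_V_mat_nonzero:
  assumes "A \<noteq> 0"
  shows "det (V_mat A) \<noteq> 0"
proof -
  have "upper_triangular (V_mat A)"
    by (auto simp: V_mat_def)
  then have "det (V_mat A) = prod_list (diag_mat (V_mat A))"
    by (rule det_upper_triangular[OF _ V_mat_carrier])
  moreover have "0 \<notin> set (diag_mat (V_mat A))"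
    using assms by (auto simp: diag_mat_def V_mat_def)
  ultimately show ?thesis
    by (simp add: prod_list_zero_iff)
qed

lemma dim_srs_param [simp]: "dim_vec (srs_param A) = degree A"
  by (simp add: srs_param_def)

text \<open>Entry 0 of the parameter is the leading coefficient of \<open>A\<close> divided by its
  constant coefficient.\<close>

lemma det_companion_srs_param_nonzero:
  assumes "0 < degree A" "coeff A 0 \<noteq> 0"
  shows "det (companion_mat (srs_param A)) \<noteq> 0"
  using assms by (intro det_companion_mat_nonzero) (auto simp: srs_param_def)

text \<open>\<open>B\<close> is the conjugate by \<open>V\<close> of the inverse of the companion
  matrix, so its inverse is the conjugate of the companion matrix itself, and powers commute with
  conjugation.\<close>

lemma mat_inv_B_mat_pow:
  assumes "0 < degree A" "coeff A 0 \<noteq> 0"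
  shows "mat_inv (B_mat A) ^\<^sub>m n = V_mat A * companion_mat (srs_param A) ^\<^sub>m n * mat_inv (V_mat A)"
proof -
  let ?d = "degree A" and ?V = "V_mat A" and ?M = "companion_mat (srs_param A)"
  let ?V' = "mat_inv ?V" and ?M' = "mat_inv ?M"
  have "A \<noteq> 0"
    using assms by auto
  note V = V_mat_carrier[of A] and V' = mat_inv_inverse[OF V_mat_carrier det_V_mat_nonzero[OF this]]
  have M: "?M \<in> carrier_mat ?d ?d"
    using companion_mat_carrier[of "srs_param A"] by simp
  note M' = mat_inv_inverse[OF M det_companion_srs_param_nonzero[OF assms]]
  \<comment> \<open>The inverse of \<open>B\<close> is guessed and checked on one side only;
    \<open>mat_inv_unique\<close> does the rest.\<close>
  have "B_mat A * (?V * ?M * ?V') = ?V * ?M' * (?V' * ?V) * ?M * ?V'"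
    unfolding B_mat_def using V V'(1) M M'(1) by (simp add: assoc_mult_mat[of _ ?d ?d _ ?d _ ?d])
  also have "\<dots> = ?V * (?M' * ?M) * ?V'"
    using V V' M M'(1) by (simp add: assoc_mult_mat[of _ ?d ?d _ ?d _ ?d])
  also have "\<dots> = 1\<^sub>m ?d"
    using V V' M' by simp
  finally have "B_mat A * (?V * ?M * ?V') = 1\<^sub>m ?d" .
  moreover have "B_mat A \<in> carrier_mat ?d ?d" "?V * ?M * ?V' \<in> carrier_mat ?d ?d"
    unfolding B_mat_def by (intro mult_carrier_mat[of _ ?d ?d] V V'(1) M M'(1))+
  ultimately have "mat_inv (B_mat A) = ?V * ?M * ?V'"
    by (intro mat_inv_unique)
  with V V' M have "similar_mat_wit (mat_inv (B_mat A)) ?M ?V ?V'"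
    unfolding similar_mat_wit_def Let_def by simp
  then show ?thesis
    by (rule similar_mat_wit_pow_id)
qed

section \<open>The quotient ring\<close>

lemma ideal_poly_ideal: "ideal (poly_ideal A) class_ring"
  unfolding poly_ideal_def by (rule cring.cgenideal_ideal[OF class_cring.cring_axioms]) simp

text \<open>This reduces every ring operation of the quotient to an operation on polynomial
  representatives.\<close>

lemma quot_class_ring_hom: "ring_hom_ring class_ring (quot_ring A) (quot_class A)"
proof -
  have "quot_class A = (+>\<^bsub>class_ring\<^esub>) (poly_ideal A)"
    by (simp add: quot_class_def fun_eq_iff)
  then show ?thesis
    using ideal.rcos_ring_hom_ring[OF ideal_poly_ideal] by (simp add: quot_ring_def)
qed

context
  fixes A :: "int poly"
begin

interpretation hom: ring_hom_ring class_ring "quot_ring A" "quot_class A"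
  by (rule quot_class_ring_hom)

lemma carrier_quot_ring: "carrier (quot_ring A) = range (quot_class A)"
  by (auto simp: quot_ring_def FactRing_def A_RCOSETS_def RCOSETS_def quot_class_def a_r_coset_def)

lemma quot_class_0: "\<zero>\<^bsub>quot_ring A\<^esub> = quot_class A 0"
  using hom.hom_zero by simp

lemma quot_class_add: "quot_class A p \<oplus>\<^bsub>quot_ring A\<^esub> quot_class A q = quot_class A (p + q)"
  using hom.hom_add[of p q] by simp

lemma quot_class_mult: "quot_class A p \<otimes>\<^bsub>quot_ring A\<^esub> quot_class A q = quot_class A (p * q)"
  using hom.hom_mult[of p q] by simp

lemma quot_class_uminus: "\<ominus>\<^bsub>quot_ring A\<^esub> quot_class A p = quot_class A (- p)"
proof (rule hom.S.minus_equality)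
  show "quot_class A (- p) \<oplus>\<^bsub>quot_ring A\<^esub> quot_class A p = \<zero>\<^bsub>quot_ring A\<^esub>"
    by (simp add: quot_class_add quot_class_0)
qed (simp_all add: carrier_quot_ring)

lemma quot_class_add_pow: "[n] \<cdot>\<^bsub>quot_ring A\<^esub> quot_class A p = quot_class A (of_int n * p)"
proof -
  have nat: "[k] \<cdot>\<^bsub>quot_ring A\<^esub> quot_class A p = quot_class A (of_nat k * p)" for k :: nat
    by (induction k) (simp_all add: quot_class_0 quot_class_add algebra_simps)
  show ?thesis
  proof (cases "n \<ge> 0")
    case True
    then show ?thesis
      by (simp add: add_pow_int_ge nat)
  next
    case False
    then show ?thesis
      by (simp add: add_pow_int_lt nat quot_class_uminus)
  qed
qed

lemma quot_class_finsum:
  assumes "finite F"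
  shows "(\<Oplus>\<^bsub>quot_ring A\<^esub> k \<in> F. quot_class A (f k)) = quot_class A (\<Sum>k\<in>F. f k)"
  using assms
  by (induction F rule: finite_induct)
     (simp_all add: quot_class_0 quot_class_add hom.S.finsum_insert carrier_quot_ring Pi_def)

end

section \<open>The Brunotte module\<close>

text \<open>The recursion of the \<open>W_k\<close> carried out in the polynomial ring, without
  reduction modulo \<open>A\<close>: \<open>pCons\<close> multiplies by the variable and adds a
  constant.\<close>

primrec brunotte_poly :: "int poly \<Rightarrow> nat \<Rightarrow> int poly" where
  "brunotte_poly A 0 = [:coeff A (degree A):]"
| "brunotte_poly A (Suc k) = pCons (coeff A (degree A - Suc k)) (brunotte_poly A k)"

lemma brunotte_basis_eq: "brunotte_basis A k = quot_class A (brunotte_poly A k)"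
  by (induction k) (simp_all add: quot_class_mult quot_class_add)

text \<open>For \<open>k \<le> degree A\<close> this exhibits \<open>W_k\<close> as \<open>A\<close>
  with its lowest \<open>degree A - k\<close> coefficients cut off and the rest shifted
  down.\<close>

lemma coeff_brunotte_poly:
  "coeff (brunotte_poly A k) i = (if i \<le> k then coeff A (degree A - (k - i)) else 0)"
  by (induction k arbitrary: i) (auto simp: coeff_pCons split: nat.split)

text \<open>The representative of degree less than \<open>d\<close>; its coefficient vector is \<open>V z\<close>.\<close>

definition brunotte_comb_poly :: "int poly \<Rightarrow> int vec \<Rightarrow> int poly" where
  "brunotte_comb_poly A z = (\<Sum>k<degree A. Polynomial.smult (z $ k) (brunotte_poly A k))"

lemma brunotte_comb_eq: "brunotte_comb A z = quot_class A (brunotte_comb_poly A z)"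
  by (simp add: brunotte_comb_def brunotte_comb_poly_def brunotte_basis_eq quot_class_add_pow
      quot_class_finsum of_int_poly)

lemma coeff_brunotte_comb_poly:
  "coeff (brunotte_comb_poly A z) i = (\<Sum>k<degree A. z $ k * coeff (brunotte_poly A k) i)"
  by (simp add: brunotte_comb_poly_def coeff_sum)

text \<open>Column \<open>k\<close> of \<open>V\<close> is the coefficient vector of
  \<open>W_k\<close>, so \<open>V\<close> changes coordinates from the \<open>W_k\<close> to the
  powers of the variable.\<close>

lemma V_mat_mult_vec_index:
  assumes "z \<in> carrier_vec (degree A)" "i < degree A"
  shows "(V_mat A *\<^sub>v real_vec z) $ i = real_of_int (coeff (brunotte_comb_poly A z) i)"
proof -
  have "(V_mat A *\<^sub>v real_vec z) $ i = (\<Sum>k<degree A. V_mat A $$ (i, k) * real_of_int (z $ k))"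
    using assms V_mat_carrier[of A] by (simp add: scalar_prod_def atLeast0LessThan)
  also have "\<dots> = (\<Sum>k<degree A. real_of_int (z $ k * coeff (brunotte_poly A k) i))"
    using assms(2) by (intro sum.cong) (auto simp: V_mat_def coeff_brunotte_poly)
  finally show ?thesis
    by (simp add: coeff_brunotte_comb_poly)
qed

lemma degree_brunotte_comb_poly:
  assumes "0 < degree A"
  shows "degree (brunotte_comb_poly A z) < degree A"
proof -
  have "coeff (brunotte_comb_poly A z) i = 0" if "degree A - 1 < i" for i
    using that by (auto simp: coeff_brunotte_comb_poly coeff_brunotte_poly intro!: sum.neutral)
  then have "degree (brunotte_comb_poly A z) \<le> degree A - 1"
    by (intro degree_le) auto
  with assms show ?thesis
    by simp
qed

text \<open>Equal classes have equal representatives of degree below that of \<open>A\<close>; these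
  determine \<open>V z\<close>, and \<open>V\<close> is invertible.\<close>

lemma inj_on_brunotte_comb:
  assumes "0 < degree A"
  shows "inj_on (brunotte_comb A) (carrier_vec (degree A))"
proof (rule inj_onI)
  let ?V = "V_mat A"
  fix y z :: "int vec"
  assume y: "y \<in> carrier_vec (degree A)" and z: "z \<in> carrier_vec (degree A)"
    and "brunotte_comb A y = brunotte_comb A z"
  then have dvd: "A dvd brunotte_comb_poly A y - brunotte_comb_poly A z"
    by (simp add: brunotte_comb_eq quot_class_eq_iff)
  moreover have "degree (brunotte_comb_poly A y - brunotte_comb_poly A z) < degree A"
    using assms by (intro degree_diff_less degree_brunotte_comb_poly)
  \<comment> \<open>A nonzero multiple of \<open>A\<close> would have degree at least
    \<open>degree A\<close>.\<close>
  ultimately have "brunotte_comb_poly A y = brunotte_comb_poly A z"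
    using dvd_imp_degree_le[OF dvd] by fastforce
  then have Vyz: "?V *\<^sub>v real_vec y = ?V *\<^sub>v real_vec z"
    using V_mat_carrier[of A] by (intro eq_vecI)
      (auto simp: V_mat_mult_vec_index[OF y] V_mat_mult_vec_index[OF z]
        simp del: index_mult_mat_vec)
  from assms have "A \<noteq> 0"
    by auto
  note V = V_mat_carrier[of A] mat_inv_inverse[OF V_mat_carrier det_V_mat_nonzero[OF this]]
  have "mat_inv ?V *\<^sub>v (?V *\<^sub>v real_vec x) = real_vec x" if "x \<in> carrier_vec (degree A)" for x
    using V that by (simp flip: assoc_mult_mat_vec)
  then have eq: "real_vec y = real_vec z"
    using y z Vyz by metis
  show "y = z"
  proof (rule eq_vecI)
    fix i assume "i < dim_vec z"
    with arg_cong[OF eq, of "\<lambda>v. v $ i"] y z show "y $ i = z $ i"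
      by simp
  qed (use y z in simp)
qed

text \<open>The integer combinations form a subgroup containing the generators, by unit vectors;
  conversely, any subgroup containing the generators contains their combinations.\<close>

lemma brunotte_module_eq: "brunotte_module A = brunotte_comb A ` carrier_vec (degree A)"
proof
  interpret hom: ring_hom_ring class_ring "quot_ring A" "quot_class A"
    by (rule quot_class_ring_hom)
  let ?G = "add_monoid (quot_ring A)" and ?C = "carrier_vec (degree A) :: int vec set"
  have basis: "brunotte_basis A k \<in> carrier (quot_ring A)" for k
    by (simp add: brunotte_basis_eq carrier_quot_ring)
  have "subgroup (brunotte_comb A ` ?C) ?G"
  proof (rule hom.S.add.subgroupI)
    show "brunotte_comb A ` ?C \<subseteq> carrier (quot_ring A)"
      by (auto simp: brunotte_comb_eq carrier_quot_ring)
    show "brunotte_comb A ` ?C \<noteq> {}"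
      by (metis empty_iff image_eqI zero_carrier_vec)
    fix P assume "P \<in> brunotte_comb A ` ?C"
    then obtain y where y: "y \<in> ?C" "P = brunotte_comb A y"
      by blast
    have "brunotte_comb_poly A (- y) = - brunotte_comb_poly A y"
      using y by (simp add: brunotte_comb_poly_def sum_negf)
    then have "\<ominus>\<^bsub>quot_ring A\<^esub> P = brunotte_comb A (- y)"
      by (simp add: y brunotte_comb_eq quot_class_uminus)
    then show "\<ominus>\<^bsub>quot_ring A\<^esub> P \<in> brunotte_comb A ` ?C"
      using y by auto
    fix Q assume "Q \<in> brunotte_comb A ` ?C"
    then obtain z where z: "z \<in> ?C" "Q = brunotte_comb A z"
      by blast
    have "brunotte_comb_poly A (y + z) = brunotte_comb_poly A y + brunotte_comb_poly A z"
      using y z by (simp add: brunotte_comb_poly_def smult_add_left sum.distrib)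
    then have "P \<oplus>\<^bsub>quot_ring A\<^esub> Q = brunotte_comb A (y + z)"
      by (simp add: y z brunotte_comb_eq quot_class_add)
    then show "P \<oplus>\<^bsub>quot_ring A\<^esub> Q \<in> brunotte_comb A ` ?C"
      using y z by auto
  qed
  moreover have "brunotte_basis A k \<in> brunotte_comb A ` ?C" if k: "k < degree A" for k
  proof -
    have "brunotte_comb_poly A (unit_vec (degree A) k)
        = (\<Sum>j<degree A. if j = k then brunotte_poly A k else 0)"
      unfolding brunotte_comb_poly_def using k by (intro sum.cong) auto
    then have "brunotte_basis A k = brunotte_comb A (unit_vec (degree A) k)"
      using k by (simp add: brunotte_comb_eq brunotte_basis_eq)
    then show ?thesis
      by simp
  qed
  ultimately show "brunotte_module A \<subseteq> brunotte_comb A ` ?C"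
    unfolding brunotte_module_def by (intro hom.S.add.generate_subgroup_incl) auto
  have sub: "subgroup (brunotte_module A) ?G"
    unfolding brunotte_module_def using basis by (intro hom.S.add.generate_is_subgroup) auto
  \<comment> \<open>Generalised to partial index sets \<open>F\<close> for induction;
    \<open>F = {..<degree A}\<close> is the case wanted.\<close>
  have "quot_class A (\<Sum>k\<in>F. Polynomial.smult (y $ k) (brunotte_poly A k)) \<in> brunotte_module A"
    if "finite F" "F \<subseteq> {..<degree A}" for F and y :: "int vec"
    using that
  proof (induction F rule: finite_induct)
    case empty
    then show ?case
      using subgroup.one_closed[OF sub] by (simp add: quot_class_0)
  next
    case (insert k F)
    have "brunotte_basis A k \<in> brunotte_module A"
      unfolding brunotte_module_def using insert.prems by (intro generate.incl) auto
    then have "[y $ k] \<cdot>\<^bsub>quot_ring A\<^esub> brunotte_basis A k \<in> brunotte_module A"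
      by (rule hom.S.add.subgroup_int_pow_closed[OF sub])
    then have "quot_class A (Polynomial.smult (y $ k) (brunotte_poly A k)) \<in> brunotte_module A"
      by (simp add: brunotte_basis_eq quot_class_add_pow of_int_poly)
    with insert show ?case
      using subgroup.m_closed[OF sub] by (simp flip: quot_class_add)
  qed
  then show "brunotte_comb A ` ?C \<subseteq> brunotte_module A"
    by (auto simp: brunotte_comb_eq brunotte_comb_poly_def)
qed

section \<open>Conjugacy of backward division and the shift radix system\<close>

lemma srs_map_carrier: "srs_map (srs_param A) z \<in> carrier_vec (degree A)"
  by (simp add: srs_map_def)

lemma srs_map_pow_carrier:
  "z \<in> carrier_vec (degree A) \<Longrightarrow> (srs_map (srs_param A) ^^ n) z \<in> carrier_vec (degree A)"
  by (cases n) (simp_all add: srs_map_carrier)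

text \<open>The conjugacy already holds exactly for these representatives, so coefficients can be
  compared without any reduction modulo \<open>A\<close>.\<close>

lemma back_div_poly_brunotte_comb_poly:
  assumes d: "0 < degree A" and z: "z \<in> carrier_vec (degree A)"
  shows "back_div_poly A (brunotte_comb_poly A z) = brunotte_comb_poly A (srs_map (srs_param A) z)"
proof (rule poly_eqI)
  fix i
  obtain d' where d': "degree A = Suc d'"
    using d by (cases "degree A") auto
  let ?r = "srs_param A" and ?c = "coeff (brunotte_comb_poly A z)" and ?b = "brunotte_poly A"
  have "?r \<bullet> real_vec z
      = (\<Sum>k<degree A. real_of_int (coeff A (degree A - k)) / real_of_int (coeff A 0) * real_of_int (z $ k))"
    using z by (simp add: scalar_prod_def srs_param_def atLeast0LessThan)
  also have "\<dots> = real_of_int (?c 0) / real_of_int (coeff A 0)"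
    by (simp add: coeff_brunotte_comb_poly coeff_brunotte_poly sum_divide_distrib mult.commute)
  finally have floor: "\<lfloor>?r \<bullet> real_vec z\<rfloor> = ?c 0 div coeff A 0"
    by (simp add: floor_divide_of_int_eq)
  have srs: "srs_map ?r z $ k = (if k < d' then z $ Suc k else - (?c 0 div coeff A 0))"
    if "k < Suc d'" for k
    using that by (simp add: srs_map_def d' floor)
  \<comment> \<open>The polynomial subtracted by backward division is thus the quotient times
    \<open>W_k\<close> for \<open>k = d'\<close>, matching the last coordinate of the
    \<open>srs_map\<close> image.\<close>
  have last: "coeff (?b d') i = coeff A (Suc i)"
    by (auto simp: coeff_brunotte_poly d' Suc_diff_le coeff_eq_0)
  \<comment> \<open>\<open>W_0\<close> is constant and contributes nothing; coefficient
    \<open>i + 1\<close> of each later \<open>W_k\<close> is coefficient \<open>i\<close> of its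
    predecessor.\<close>
  have "?c (Suc i) = (\<Sum>k<d'. z $ Suc k * coeff (?b k) i)"
    by (simp add: coeff_brunotte_comb_poly d' sum.lessThan_Suc_shift del: sum.lessThan_Suc)
  moreover have "coeff (brunotte_comb_poly A (srs_map ?r z)) i
      = (\<Sum>k<d'. z $ Suc k * coeff (?b k) i) - ?c 0 div coeff A 0 * coeff (?b d') i"
    by (simp add: coeff_brunotte_comb_poly[of A "srs_map ?r z"] d' srs cong: sum.cong_simp)
  ultimately show "coeff (back_div_poly A (brunotte_comb_poly A z)) i
      = coeff (brunotte_comb_poly A (srs_map ?r z)) i"
    by (simp add: coeff_back_div_poly last)
qed

lemma back_div_pow_brunotte_comb:
  assumes "0 < degree A" "coeff A 0 \<noteq> 0" "z \<in> carrier_vec (degree A)"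
  shows "(back_div A ^^ n) (brunotte_comb A z) = brunotte_comb A ((srs_map (srs_param A) ^^ n) z)"
proof (induction n)
  case (Suc n)
  then show ?case
    using assms by (simp add: brunotte_comb_eq back_div_quot_class
        back_div_poly_brunotte_comb_poly srs_map_pow_carrier)
qed simp

lemma brunotte_coord_comb:
  assumes "0 < degree A" "z \<in> carrier_vec (degree A)"
  shows "brunotte_coord A (brunotte_comb A z) = z"
  unfolding brunotte_coord_def by (rule the_inv_into_f_f[OF inj_on_brunotte_comb[OF assms(1)] assms(2)])

text \<open>Identifies the inverse of the coordinate map, as it occurs in the theorem, with the
  explicit combination.\<close>

lemma inv_into_brunotte_coord:
  assumes "0 < degree A" "z \<in> carrier_vec (degree A)"
  shows "inv_into (brunotte_module A) (brunotte_coord A) z = brunotte_comb A z"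
proof (rule inv_into_f_eq)
  show "inj_on (brunotte_coord A) (brunotte_module A)"
    using assms(1) by (auto intro!: inj_onI simp: brunotte_module_eq brunotte_coord_comb)
qed (use assms in \<open>simp_all add: brunotte_module_eq brunotte_coord_comb\<close>)

text \<open>Intersecting with the module leaves only combinations of the \<open>W_k\<close>; on
  these the conjugacy applies, and injectivity turns equality of classes into equality of integer
  vectors.\<close>

lemma back_div_preimage:
  assumes "0 < degree A" "coeff A 0 \<noteq> 0" "z \<in> carrier_vec (degree A)"
  shows "{Q \<in> carrier (quot_ring A). (back_div A ^^ n) Q = brunotte_comb A z} \<inter> brunotte_module A
    = brunotte_comb A ` {y \<in> carrier_vec (degree A). (srs_map (srs_param A) ^^ n) y = z}"
proof -
  have "(back_div A ^^ n) (brunotte_comb A y) = brunotte_comb A z \<longleftrightarrow> (srs_map (srs_param A) ^^ n) y = z"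
    if "y \<in> carrier_vec (degree A)" for y
    using inj_on_eq_iff[OF inj_on_brunotte_comb[OF assms(1)] srs_map_pow_carrier[OF that] assms(3)]
    by (simp add: back_div_pow_brunotte_comb[OF assms(1,2) that])
  moreover have "brunotte_comb A y \<in> carrier (quot_ring A)" for y
    by (simp add: brunotte_comb_eq carrier_quot_ring)
  ultimately show ?thesis
    unfolding brunotte_module_eq by blast
qed

theorem theorem5p12:
  fixes A :: "int poly" and d :: nat
  assumes "d \<ge> 1"
    and "degree A = d"
    and "coeff A d \<noteq> 0"
    and "coeff A 0 \<ge> 2"
    and "expanding A"
  shows "\<forall>z \<in> carrier_vec d.
    brunotte_tile A (inv_into (brunotte_module A) (brunotte_coord A) z) =
      (\<lambda>t. V_mat A *\<^sub>v t) ` srs_tile (srs_param A) z"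
proof
  fix z :: "int vec" assume "z \<in> carrier_vec d"
  with assms have z: "z \<in> carrier_vec (degree A)" and d: "0 < degree A" and a0: "coeff A 0 \<noteq> 0"
    and A: "A \<noteq> 0"
    by auto
  let ?V = "V_mat A" and ?M = "companion_mat (srs_param A)" and ?C = "carrier_vec (degree A)"
  let ?Y = "\<lambda>n. {y \<in> ?C. (srs_map (srs_param A) ^^ n) y = z}"
  note V = V_mat_carrier[of A] mat_inv_inverse[OF V_mat_carrier det_V_mat_nonzero[OF A]]
  have M: "?M ^\<^sub>m n \<in> carrier_mat (degree A) (degree A)" for n
    using companion_mat_carrier[of "srs_param A"] by (intro pow_carrier_mat) simp
  \<comment> \<open>The trailing inverse of \<open>V\<close> in the formula for the powers cancels
    against \<open>V\<close>.\<close>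
  have conj: "mat_inv (B_mat A) ^\<^sub>m n *\<^sub>v (?V *\<^sub>v x) = ?V *\<^sub>v (?M ^\<^sub>m n *\<^sub>v x)" if "x \<in> ?C" for n x
  proof -
    have VM: "?V * ?M ^\<^sub>m n \<in> carrier_mat (degree A) (degree A)"
      by (rule mult_carrier_mat[OF V(1) M])
    have "mat_inv (B_mat A) ^\<^sub>m n * ?V = ?V * ?M ^\<^sub>m n"
      unfolding mat_inv_B_mat_pow[OF d a0] assoc_mult_mat[OF VM V(2,1)] V(4)
      by (rule right_mult_one_mat[OF VM])
    moreover have "mat_inv (B_mat A) ^\<^sub>m n \<in> carrier_mat (degree A) (degree A)"
      unfolding mat_inv_B_mat_pow[OF d a0] by (rule mult_carrier_mat[OF VM V(2)])
    ultimately show ?thesis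
      using V(1) M[of n] that by (metis assoc_mult_mat_vec)
  qed
  have "brunotte_tile A (brunotte_comb A z) = lower_hausdorff_limit (degree A)
      (\<lambda>n. (\<lambda>t. ?V *\<^sub>v t) ` (\<lambda>y. ?M ^\<^sub>m n *\<^sub>v real_vec y) ` ?Y n)"
    unfolding brunotte_tile_def back_div_preimage[OF d a0 z] image_image
    by (intro arg_cong[of _ _ "lower_hausdorff_limit (degree A)"] ext image_cong)
       (auto simp: brunotte_coord_comb[OF d] conj)
  also have "\<dots> = (\<lambda>t. ?V *\<^sub>v t) ` srs_tile (srs_param A) z"
    unfolding srs_tile_def dim_srs_param
    by (intro lower_hausdorff_limit_image[OF V]) (auto intro!: mult_mat_vec_carrier[OF M])
  finally show "brunotte_tile A (inv_into (brunotte_module A) (brunotte_coord A) z) =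
      (\<lambda>t. ?V *\<^sub>v t) ` srs_tile (srs_param A) z"
    by (simp add: inv_into_brunotte_coord[OF d z])
qed

end
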